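(* The quasi-order $\big(D_\omega(\mathbf{\Sigma}^0_1)(\mathcal{P}\omega),\leq_w\big)$ is ill-founded; that is, there exists a sequence $(\mathcal{A}_n)_{n\in\omega}$ of sets in $D_\omega(\mathbf{\Sigma}^0_1)(\mathcal{P}\omega)$ such that $\mathcal{A}_{n+1}<_w\mathcal{A}_n$ for every $n\in\omega$.
   Context: The Scott domain $\mathcal{P}\omega$ is the power set of $\omega$ with the topology generated by the basic open sets $\mathcal{O}_F=\{x\subseteq\omega\mid F\subseteq x\}$ for finite $F\subseteq\omega$. For a sequence $(A_\beta)_{\beta<\alpha}$ of subsets of a space, $D_\alpha\big((A_\beta)_{\beta<\alpha}\big)=\bigcup\{A_\beta\setminus\bigcup_{\gamma<\beta}A_\gamma \mid \beta<\alpha,\ \alpha \text{ and } \beta \text{ have different parities}\}$ (limit ordinals are even); $D_\omega(\mathbf{\Sigma}^0_1)(\mathcal{P}\omega)$ is the class of all sets $D_\omega\big((A_n)_{n<\omega}\big)$ with every $A_n$ open in $\mathcal{P}\omega$. For $\mathcal{A},\mathcal{B}\subseteq\mathcal{P}\omega$, $\mathcal{A}\leq_w\mathcal{B}$ (Wadge reducibility) means there is a continuous $f:\mathcal{P}\omega\to\mathcal{P}\omega$ with $f^{-1}[\mathcal{B}]=\mathcal{A}$; $\mathcal{A}<_w\mathcal{B}$ means $\mathcal{A}\leq_w\mathcal{B}$ and $\mathcal{B}\not\leq_w\mathcal{A}$. *)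

theory Defs
  imports "HOL-Analysis.Analysis"
begin

definition basic_open :: "nat set \<Rightarrow> nat set set" where
  "basic_open F = {x. F \<subseteq> x}"

definition scott_domain :: "nat set topology" where
  "scott_domain = topology_generated_by {basic_open F |F. finite F}"

lemma topspace_scott_domain [simp]: "topspace scott_domain = UNIV"
proof -
  have "basic_open {} = UNIV"
    by (simp add: basic_open_def)
  then have "UNIV \<in> {basic_open F |F. finite F}"
    by (metis (mono_tags, lifting) finite.emptyI mem_Collect_eq)
  then show ?thesis
    unfolding scott_domain_def topology_generated_by_topspace by blast
qed

text \<open>
  The difference operation \<open>D\<^sub>\<alpha>\<close> for \<open>\<alpha> = \<omega>\<close>: limit ordinals count as even, so the
  indices \<open>n < \<omega>\<close> whose parity differs from that of \<open>\<omega>\<close> are the odd ones.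
\<close>

definition diff_omega :: "(nat \<Rightarrow> 'a set) \<Rightarrow> 'a set" where
  "diff_omega A = \<Union> {A n - (\<Union>m<n. A m) |n. odd n}"

definition D_omega_open :: "nat set set set" where
  "D_omega_open = {diff_omega A |A. \<forall>n. openin scott_domain (A n)}"

text \<open>Since the carrier is the whole type, the preimage needs no relativisation.\<close>

definition wadge_le :: "nat set set \<Rightarrow> nat set set \<Rightarrow> bool" (infix "\<le>\<^sub>w" 50) where
  "A \<le>\<^sub>w B \<longleftrightarrow> (\<exists>f. continuous_map scott_domain scott_domain f \<and> f -` B = A)"

definition wadge_less :: "nat set set \<Rightarrow> nat set set \<Rightarrow> bool" (infix "<\<^sub>w" 50) where
  "A <\<^sub>w B \<longleftrightarrow> A \<le>\<^sub>w B \<and> \<not> B \<le>\<^sub>w A"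

end

theory Submission
  imports Defs
begin

text \<open>
  Read the even elements \<open>2 i\<close> of \<open>x \<subseteq> \<omega>\<close> as vertices of the infinite path
  \<open>0 - 1 - 2 - \<dots>\<close> and the odd elements as counters. For \<open>a :: nat \<Rightarrow> nat\<close> the set \<open>path_set a\<close>
  is arranged so that above the single vertex \<open>i\<close> one can alternate between the set and its
  complement exactly \<open>2 * a i + 1\<close> times, while two distinct vertices have an upper bound in the
  set only if they are adjacent. A reduction of \<open>path_set a\<close> to \<open>path_set b\<close> therefore
  induces a map \<open>p\<close> on vertices with \<open>p (i + 1) \<le> p i + 1\<close> that does not decrease the
  alternation number, whence \<open>a i \<le> b (p 0 + i)\<close> for monotone \<open>b\<close>. As the number of alternations above the
  empty set is infinite, there is no bound on these numbers along the path, so they can be given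
  slower and slower growth rates: the functions \<open>i div (n + 1) + 1\<close> yield the descending chain.
\<close>

section \<open>The Scott topology\<close>

lemma openin_scott_upclosed:
  assumes "openin scott_domain U" "x \<in> U" "x \<subseteq> y"
  shows "y \<in> U"
proof -
  have "generate_topology_on {basic_open F |F. finite F} U"
    using assms(1) by (simp add: scott_domain_def openin_topology_generated_by_iff)
  then have "\<forall>x\<in>U. \<forall>y. x \<subseteq> y \<longrightarrow> y \<in> U"
  proof induction
    case (Basis s)
    then show ?case by (auto simp: basic_open_def)
  qed blast+
  with assms(2,3) show ?thesis by blast
qed

lemma openin_basic_open: "finite F \<Longrightarrow> openin scott_domain (basic_open F)"
  unfolding scott_domain_def by (rule topology_generated_by_Basis) blast

lemma openin_scottI:
  assumes "\<And>x. x \<in> U \<Longrightarrow> \<exists>F. finite F \<and> F \<subseteq> x \<and> basic_open F \<subseteq> U"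
  shows "openin scott_domain U"
proof (subst openin_subopen, intro ballI)
  fix x assume "x \<in> U"
  then obtain F where "finite F" "F \<subseteq> x" "basic_open F \<subseteq> U"
    using assms by blast
  moreover from \<open>F \<subseteq> x\<close> have "x \<in> basic_open F"
    by (simp add: basic_open_def)
  ultimately show "\<exists>T. openin scott_domain T \<and> x \<in> T \<and> T \<subseteq> U"
    using openin_basic_open by blast
qed

lemma continuous_scott_mono:
  assumes "continuous_map scott_domain scott_domain f" "x \<subseteq> y"
  shows "f x \<subseteq> f y"
proof
  fix k assume "k \<in> f x"
  have "openin scott_domain {z \<in> topspace scott_domain. f z \<in> basic_open {k}}"
    using assms(1) openin_basic_open[of "{k}"] by (intro openin_continuous_map_preimage) auto
  from openin_scott_upclosed[OF this _ assms(2)] \<open>k \<in> f x\<close> show "k \<in> f y"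
    by (simp add: basic_open_def)
qed

text \<open>The reduction collapses \<open>W\<close> to the top point \<open>UNIV\<close>, which
  lies outside \<open>B\<close>. It is continuous because every nonempty open \<open>U\<close>
  contains \<open>UNIV\<close>, so the preimage of \<open>U\<close> is
  \<open>U \<union> W\<close>.\<close>

lemma wadge_le_Diff_open:
  assumes "openin scott_domain W" "UNIV \<notin> B"
  shows "(B - W) \<le>\<^sub>w B"
proof -
  define f where "f x = (if x \<in> W then UNIV else x)" for x :: "nat set"
  have "openin scott_domain {x. f x \<in> U}" if U: "openin scott_domain U" for U
  proof (cases "U = {}")
    case False
    then have "UNIV \<in> U"
      using openin_scott_upclosed[OF U] by blast
    then have "{x. f x \<in> U} = U \<union> W"
      using openin_scott_upclosed[OF U] by (auto simp: f_def)
    then show ?thesis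
      using U assms(1) by (simp add: openin_Un)
  qed simp
  then have "continuous_map scott_domain scott_domain f"
    by (simp add: continuous_map_def)
  moreover have "f -` B = B - W"
    using assms(2) by (auto simp: f_def split: if_splits)
  ultimately show ?thesis
    unfolding wadge_le_def by blast
qed

section \<open>Alternation along increasing sequences\<close>

definition first_index :: "(nat \<Rightarrow> 'a set) \<Rightarrow> 'a \<Rightarrow> nat \<Rightarrow> bool" where
  "first_index A x n \<longleftrightarrow> x \<in> A n \<and> (\<forall>m<n. x \<notin> A m)"

lemma first_index_unique: "first_index A x m \<Longrightarrow> first_index A x n \<Longrightarrow> m = n"
  unfolding first_index_def by (meson linorder_neqE_nat)

lemma first_index_exists:
  assumes "x \<in> A n"
  obtains m where "first_index A x m" "m \<le> n"
proof
  show "first_index A x (LEAST m. x \<in> A m)"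
    unfolding first_index_def using assms by (auto intro: LeastI dest: not_less_Least)
  show "(LEAST m. x \<in> A m) \<le> n"
    using assms by (rule Least_le)
qed

lemma diff_omega_iff: "x \<in> diff_omega A \<longleftrightarrow> (\<exists>n. odd n \<and> first_index A x n)"
  unfolding diff_omega_def first_index_def by auto

lemma diff_omega_first_index: "first_index A x n \<Longrightarrow> x \<in> diff_omega A \<longleftrightarrow> odd n"
  unfolding diff_omega_iff by (metis first_index_unique)

text \<open>Open sets are upward closed, so the first index cannot grow along an increasing
  sequence. Each change of membership flips its parity, so it drops by at least one each
  time.\<close>

lemma alternation_bound:
  fixes y :: "nat \<Rightarrow> nat set"
  assumes op: "\<And>n. openin scott_domain (A n)"
    and mono: "\<And>k. k < m \<Longrightarrow> y k \<subseteq> y (Suc k)"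
    and alt: "\<And>k. k \<le> m \<Longrightarrow> y k \<in> diff_omega A \<longleftrightarrow> even k"
    and first: "first_index A (y 0) n"
  shows "m \<le> n"
proof -
  have "\<exists>j. j + k \<le> n \<and> first_index A (y k) j" if "k \<le> m" for k
    using that
  proof (induction k)
    case 0
    then show ?case using first by auto
  next
    case (Suc k)
    then obtain j where j: "j + k \<le> n" "first_index A (y k) j"
      by auto
    have "y (Suc k) \<in> A j"
      using openin_scott_upclosed[OF op] j(2) mono Suc.prems
      unfolding first_index_def by auto
    then obtain j' where j': "first_index A (y (Suc k)) j'" "j' \<le> j"
      by (rule first_index_exists)
    have "odd j \<longleftrightarrow> even k" "odd j' \<longleftrightarrow> odd k"
      using alt[of k] alt[of "Suc k"] Suc.prems
      by (simp_all add: diff_omega_first_index[OF j(2)] diff_omega_first_index[OF j'(1)])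
    then have "j' \<noteq> j" by auto
    with j'(2) j(1) have "j' + Suc k \<le> n" by simp
    with j'(1) show ?case by blast
  qed
  from this[of m] show ?thesis by auto
qed

section \<open>Sets built on the infinite path\<close>

definition verts :: "nat set \<Rightarrow> nat set" where
  "verts x = {i. 2 * i \<in> x}"

definition counters :: "nat set \<Rightarrow> nat set" where
  "counters x = {k. 2 * k + 1 \<in> x}"

definition join :: "nat set \<Rightarrow> nat set \<Rightarrow> nat set" where
  "join V C = (\<lambda>i. 2 * i) ` V \<union> (\<lambda>k. 2 * k + 1) ` C"

lemma verts_join [simp]: "verts (join V C) = V"
  unfolding verts_def join_def by (auto; presburger)

lemma counters_join [simp]: "counters (join V C) = C"
  unfolding counters_def join_def by (auto; presburger)

lemma finite_join: "finite V \<Longrightarrow> finite C \<Longrightarrow> finite (join V C)"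
  by (simp add: join_def)

lemma join_subset_iff: "join V C \<subseteq> x \<longleftrightarrow> V \<subseteq> verts x \<and> C \<subseteq> counters x"
  unfolding join_def verts_def counters_def by auto

lemma join_mono: "V \<subseteq> V' \<Longrightarrow> C \<subseteq> C' \<Longrightarrow> join V C \<subseteq> join V' C'"
  unfolding join_def by auto

lemma verts_mono: "x \<subseteq> y \<Longrightarrow> verts x \<subseteq> verts y"
  unfolding verts_def by auto

text \<open>The first index of a set with the single vertex \<open>i\<close> is
  \<open>2 * a i + 1\<close> minus the least strict upper bound of its counters.\<close>

definition path_open :: "(nat \<Rightarrow> nat) \<Rightarrow> nat \<Rightarrow> nat set set" where
  "path_open a n = {x.
     (\<exists>i\<in>verts x. 2 * a i < n \<or> (\<exists>k\<in>counters x. 2 * a i \<le> k + n)) \<or>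
     (\<exists>i\<in>verts x. \<exists>j\<in>verts x. i < j \<and> (0 < n \<or> j \<noteq> Suc i \<or> counters x \<noteq> {}))}"

definition path_set :: "(nat \<Rightarrow> nat) \<Rightarrow> nat set set" where
  "path_set a = diff_omega (path_open a)"

text \<open>Membership is always witnessed by at most two vertices and one counter, and it survives
  adding further elements.\<close>

lemma openin_path_open: "openin scott_domain (path_open a n)"
proof (rule openin_scottI)
  fix x assume x: "x \<in> path_open a n"
  have *: "\<exists>F. finite F \<and> F \<subseteq> x \<and> basic_open F \<subseteq> path_open a n"
    if fin: "finite V" "finite C" and sub: "V \<subseteq> verts x" "C \<subseteq> counters x"
      and up: "\<And>y. V \<subseteq> verts y \<Longrightarrow> C \<subseteq> counters y \<Longrightarrow> y \<in> path_open a n" for V C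
  proof (intro exI conjI)
    show "finite (join V C)" using fin by (rule finite_join)
    show "join V C \<subseteq> x" using sub by (simp add: join_subset_iff)
    show "basic_open (join V C) \<subseteq> path_open a n"
    proof
      fix y assume "y \<in> basic_open (join V C)"
      then show "y \<in> path_open a n"
        by (intro up) (simp_all add: basic_open_def join_subset_iff)
    qed
  qed
  from x consider i where "i \<in> verts x" "2 * a i < n"
    | i k where "i \<in> verts x" "k \<in> counters x" "2 * a i \<le> k + n"
    | i j where "i \<in> verts x" "j \<in> verts x" "i < j" "0 < n \<or> j \<noteq> Suc i"
    | i j k where "i \<in> verts x" "j \<in> verts x" "i < j" "k \<in> counters x"
    unfolding path_open_def by blast
  then show "\<exists>F. finite F \<and> F \<subseteq> x \<and> basic_open F \<subseteq> path_open a n"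
  proof cases
    case 1
    then show ?thesis by (intro *[of "{i}" "{}"]) (auto simp: path_open_def)
  next
    case 2
    then show ?thesis by (intro *[of "{i}" "{k}"]) (auto simp: path_open_def)
  next
    case 3
    then show ?thesis by (intro *[of "{i, j}" "{}"]) (auto simp: path_open_def)
  next
    case 4
    then show ?thesis by (intro *[of "{i, j}" "{k}"]) (auto simp: path_open_def)
  qed
qed

lemma path_set_in_D_omega_open: "path_set a \<in> D_omega_open"
  unfolding D_omega_open_def path_set_def using openin_path_open by blast

section \<open>First indices and the shape of the elements of \<open>path_set\<close>\<close>

text \<open>The least strict upper bound: 0 for the empty set, maximum plus one for a nonempty
  finite set. An infinite set has no level.\<close>

definition level :: "nat set \<Rightarrow> nat \<Rightarrow> bool" where
  "level C m \<longleftrightarrow> C \<subseteq> {..<m} \<and> (\<forall>k. m = Suc k \<longrightarrow> k \<in> C)"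

lemma level_exists:
  assumes "C \<subseteq> {..<m}"
  obtains l where "level C l" "l \<le> m"
proof
  define l where "l = (LEAST l. C \<subseteq> {..<l})"
  have sub: "C \<subseteq> {..<l}"
    unfolding l_def using assms by (rule LeastI)
  have "k \<in> C" if "l = Suc k" for k
  proof (rule ccontr)
    assume "k \<notin> C"
    with sub that have "C \<subseteq> {..<k}"
      by (auto simp: less_Suc_eq)
    then have "l \<le> k" unfolding l_def by (rule Least_le)
    with that show False by simp
  qed
  with sub show "level C l" by (simp add: level_def)
  show "l \<le> m" unfolding l_def using assms by (rule Least_le)
qed

lemma level_lessThan [simp]: "level {..<k} m \<longleftrightarrow> m = k"
  unfolding level_def by (cases m) (auto simp: lessThan_subset_iff)

lemma path_open_single_iff:
  assumes "verts x = {i}" "level (counters x) m"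
  shows "x \<in> path_open a n \<longleftrightarrow> 2 * a i < m + n"
proof -
  have "x \<in> path_open a n \<longleftrightarrow> 2 * a i < n \<or> (\<exists>k\<in>counters x. 2 * a i \<le> k + n)"
    using assms(1) by (simp add: path_open_def)
  also have "\<dots> \<longleftrightarrow> 2 * a i < m + n"
  proof (cases m)
    case 0
    then show ?thesis using assms(2) by (auto simp: level_def)
  next
    case (Suc l)
    then have l: "l \<in> counters x" "\<And>k. k \<in> counters x \<Longrightarrow> k \<le> l"
      using assms(2) by (auto simp: level_def)
    then have "(\<exists>k\<in>counters x. 2 * a i \<le> k + n) \<longleftrightarrow> 2 * a i \<le> l + n"
      by (meson add_le_mono1 le_trans)
    with Suc show ?thesis by auto
  qed
  finally show ?thesis .
qed

lemma first_index_single: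
  assumes "verts x = {i}" "level (counters x) m" "m \<le> 2 * a i"
  shows "first_index (path_open a) x (Suc (2 * a i) - m)"
  using assms by (auto simp: first_index_def path_open_single_iff)

text \<open>Index 1 is odd, which puts the edge into the set; any further vertex or counter lowers
  the index to 0.\<close>

lemma first_index_edge:
  assumes "verts x = {i, Suc i}" "counters x = {}"
  shows "first_index (path_open a) x 1"
  using assms by (auto simp: first_index_def path_open_def)

lemma path_set_cases:
  assumes "x \<in> path_set a"
  obtains (edge) i where "verts x = {i, Suc i}" "counters x = {}"
    | (single) i m where "verts x = {i}" "level (counters x) m" "even m" "m \<le> 2 * a i"
proof -
  obtain n where n: "odd n" "x \<in> path_open a n" "\<And>m. m < n \<Longrightarrow> x \<notin> path_open a m"
    using assms by (auto simp: path_set_def diff_omega_iff first_index_def)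
  \<comment> \<open>The index \<open>n\<close> is odd, hence positive. Avoiding
    \<open>path_open a 0\<close> rules out nonadjacent vertices, counters on an edge, and large
    counters on a single vertex.\<close>
  have n0: "x \<notin> path_open a 0"
    using n(1,3) by (cases n) auto
  obtain i where i: "i \<in> verts x"
    using n(2) by (auto simp: path_open_def)
  show ?thesis
  proof (cases "verts x = {i}")
    case True
    have "counters x \<subseteq> {..<2 * a i}"
      using n0 i by (force simp: path_open_def)
    then obtain m where m: "level (counters x) m" "m \<le> 2 * a i"
      by (rule level_exists)
    then have "even m"
      using assms first_index_single[of x i m a] True
      by (simp add: path_set_def diff_omega_first_index)
    with True m show ?thesis by (intro single)
  next
    case False
    then obtain j where "j \<in> verts x" "j \<noteq> i"
      using i by blast
    then obtain p q where pq: "p \<in> verts x" "q \<in> verts x" "p < q"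
      using i by (metis linorder_neqE_nat)
    have adj: "j' = Suc i'" if "i' \<in> verts x" "j' \<in> verts x" "i' < j'" for i' j'
      using n0 that by (auto simp: path_open_def)
    have "verts x = {p, Suc p}"
    proof -
      have q: "q = Suc p" using adj pq by blast
      have "r = p \<or> r = Suc p" if "r \<in> verts x" for r
        using adj[OF that pq(1)] adj[OF pq(1) that] adj[OF that pq(2)] q
        by (metis less_SucI linorder_neqE_nat n_not_Suc_n)
      with pq q show ?thesis by auto
    qed
    moreover have "counters x = {}"
      using n0 pq by (auto simp: path_open_def)
    ultimately show ?thesis by (rule edge)
  qed
qed

lemma path_set_edgeI:
  "verts x = {i, Suc i} \<Longrightarrow> counters x = {} \<Longrightarrow> x \<in> path_set a"
  using first_index_edge[of x i a] by (simp add: path_set_def diff_omega_first_index)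

lemma path_set_single_iff:
  assumes "verts x = {i}" "level (counters x) m" "m \<le> 2 * a i"
  shows "x \<in> path_set a \<longleftrightarrow> even m"
  using first_index_single[of x i m a, OF assms] assms(3)
  by (simp add: path_set_def diff_omega_first_index)

lemma path_set_not_path_open_0:
  assumes "x \<in> path_set a"
  shows "x \<notin> path_open a 0"
proof -
  obtain n where "odd n" "first_index (path_open a) x n"
    using assms by (auto simp: path_set_def diff_omega_iff)
  then show ?thesis
    by (cases n) (auto simp: first_index_def)
qed

section \<open>Reductions between path sets\<close>

text \<open>Edges do not depend on \<open>a\<close>, and above a single vertex \<open>i\<close> the
  parity of the level decides membership; \<open>a i\<close> only sets the cutoff
  \<open>2 * a i\<close>. Lowering it to \<open>2 * b i\<close> removes exactly the points in
  \<open>path_open b 0\<close>.\<close>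

lemma path_set_Diff:
  assumes "\<And>i. b i \<le> a i"
  shows "path_set b = path_set a - path_open b 0"
proof (intro equalityI subsetI)
  fix x assume x: "x \<in> path_set b"
  then have "x \<in> path_set a"
  proof (cases rule: path_set_cases)
    case (edge i)
    then show ?thesis by (rule path_set_edgeI)
  next
    case (single i m)
    with assms[of i] show ?thesis by (subst path_set_single_iff) auto
  qed
  with x show "x \<in> path_set a - path_open b 0"
    using path_set_not_path_open_0 by blast
next
  fix x assume x: "x \<in> path_set a - path_open b 0"
  then have "x \<in> path_set a" by simp
  then show "x \<in> path_set b"
  proof (cases rule: path_set_cases)
    case (edge i)
    then show ?thesis by (rule path_set_edgeI)
  next
    case (single i m)
    with x have "m \<le> 2 * b i"
      by (simp add: path_open_single_iff)
    with single show ?thesis by (subst path_set_single_iff) auto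
  qed
qed

lemma path_set_mono:
  assumes "\<And>i. b i \<le> a i"
  shows "path_set b \<le>\<^sub>w path_set a"
proof -
  \<comment> \<open>The vertices 0 and 2 are not adjacent, so the top point has first index
    0.\<close>
  have "0 \<in> verts UNIV \<and> 2 \<in> verts UNIV"
    by (simp add: verts_def)
  then have "UNIV \<in> path_open a 0"
    unfolding path_open_def by (intro CollectI disjI2 bexI[of _ 0] bexI[of _ 2]) auto
  then have "UNIV \<notin> path_set a"
    using path_set_not_path_open_0 by blast
  then show ?thesis
    unfolding path_set_Diff[of b a, OF assms]
    by (intro wadge_le_Diff_open openin_path_open)
qed

lemma path_set_le_imp_shift:
  assumes le: "path_set a \<le>\<^sub>w path_set b" and pos: "\<And>i. 0 < a i" and "mono b"
  shows "\<exists>c. \<forall>i. a i \<le> b (c + i)"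
proof -
  obtain g where g: "continuous_map scott_domain scott_domain g" "g -` path_set b = path_set a"
    using le by (auto simp: wadge_le_def)
  have pres: "g x \<in> path_set b \<longleftrightarrow> x \<in> path_set a" for x
    using g(2) by auto
  define u where "u i = join {i} {}" for i
  have "\<exists>j. verts (g (u i)) = {j} \<and> a i \<le> b j" for i
  proof -
    \<comment> \<open>The counters below \<open>k\<close> have level \<open>k\<close>, so this image
      of an increasing chain alternates up to \<open>k = 2 * a i\<close>.\<close>
    define y where "y k = g (join {i} {..<k})" for k
    have y0: "y 0 = g (u i)" by (simp add: y_def u_def)
    have alt: "y k \<in> path_set b \<longleftrightarrow> even k" if "k \<le> 2 * a i" for k
      unfolding y_def pres using that by (intro path_set_single_iff) auto
    obtain n where n: "first_index (path_open b) (y 0) n"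
      using alt[of 0] by (auto simp: path_set_def diff_omega_iff)
    have "2 * a i \<le> n"
    proof (rule alternation_bound[OF openin_path_open])
      show "y k \<subseteq> y (Suc k)" for k
        unfolding y_def by (intro continuous_scott_mono[OF g(1)] join_mono) auto
    qed (use alt n in \<open>auto simp: path_set_def\<close>)
    have "y 0 \<in> path_set b" using alt[of 0] by simp
    then show ?thesis
    proof (cases rule: path_set_cases)
      case (edge j)
      \<comment> \<open>An edge is too short for the chain, since \<open>2 * a i\<close> is at least
        2; this is where positivity of \<open>a\<close> enters.\<close>
      from first_index_unique[OF n first_index_edge[OF this]] have "n = 1" .
      with \<open>2 * a i \<le> n\<close> pos[of i] show ?thesis by simp
    next
      case (single j m)
      \<comment> \<open>Together with \<open>2 * a i \<le> n\<close> this gives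
        \<open>2 * a i \<le> 2 * b j + 1\<close>, and halving loses the extra 1.\<close>
      have "n = Suc (2 * b j) - m"
        using n first_index_single[of "y 0" j m b] single by (blast intro: first_index_unique)
      with \<open>2 * a i \<le> n\<close> single y0 show ?thesis by auto
    qed
  qed
  then obtain p where p: "\<And>i. verts (g (u i)) = {p i}" "\<And>i. a i \<le> b (p i)"
    by metis
  have step: "p (Suc i) \<le> Suc (p i)" for i
  proof -
    \<comment> \<open>The edge lies above both of its vertices and belongs to the set, so
      \<open>g e\<close> contains \<open>p i\<close> and \<open>p (Suc i)\<close> and avoids
      \<open>path_open b 0\<close>: these two are equal or adjacent.\<close>
    define e where "e = join {i, Suc i} {}"
    have "e \<in> path_set a" by (rule path_set_edgeI[of _ i]) (auto simp: e_def)
    then have "g e \<notin> path_open b 0"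
      using pres path_set_not_path_open_0 by blast
    moreover have "verts (g (u i)) \<subseteq> verts (g e)" "verts (g (u (Suc i))) \<subseteq> verts (g e)"
      unfolding u_def e_def
      by (intro verts_mono continuous_scott_mono[OF g(1)] join_mono; simp)+
    ultimately show ?thesis
      using p(1) by (force simp: path_open_def)
  qed
  have "p i \<le> p 0 + i" for i
  proof (induction i)
    case (Suc i)
    with step[of i] show ?case by linarith
  qed simp
  then have "a i \<le> b (p 0 + i)" for i
    using p(2) \<open>mono b\<close> by (meson le_trans monoD)
  then show ?thesis by blast
qed

section \<open>A descending chain from decreasing growth rates\<close>

theorem theorem36:
  shows "\<exists>A :: nat \<Rightarrow> nat set set.
    (\<forall>n. A n \<in> D_omega_open) \<and> (\<forall>n. A (Suc n) <\<^sub>w A n)"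
proof -
  \<comment> \<open>The outer \<open>Suc\<close> keeps the values positive. The slopes
    \<open>1 / (n + 1)\<close> strictly decrease, so no constant shift \<open>c\<close> can
    compensate in the long run.\<close>
  define a where "a n i = Suc (i div Suc n)" for n i :: nat
  have "path_set (a (Suc n)) \<le>\<^sub>w path_set (a n)" for n
    by (rule path_set_mono) (simp add: a_def div_le_mono2)
  moreover have "\<not> path_set (a n) \<le>\<^sub>w path_set (a (Suc n))" for n
  proof
    assume "path_set (a n) \<le>\<^sub>w path_set (a (Suc n))"
    moreover have "mono (a (Suc n))"
      by (intro monoI) (simp add: a_def div_le_mono)
    ultimately obtain c where c: "a n i \<le> a (Suc n) (c + i)" for i
      using path_set_le_imp_shift[of "a n" "a (Suc n)"] by (auto simp: a_def)
    \<comment> \<open>The argument \<open>Suc n * (Suc (Suc n) * t)\<close> is divisible by both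
      denominators, so the two sides differ by \<open>t\<close> up to
      \<open>c div Suc (Suc n)\<close>; any \<open>t > c\<close> gives a contradiction.\<close>
    define t where "t = Suc c"
    have "Suc n * (Suc (Suc n) * t) div Suc n \<le> (c + Suc (Suc n) * (Suc n * t)) div Suc (Suc n)"
      using c[of "Suc n * (Suc (Suc n) * t)"] unfolding a_def by (simp only: Suc_le_mono mult.left_commute)
    then have "Suc (Suc n) * t \<le> c div Suc (Suc n) + Suc n * t"
      by (simp only: nonzero_mult_div_cancel_left div_mult_self2 nat.simps(3) not_False_eq_True)
    then have "t \<le> c div Suc (Suc n)"
      by simp
    also have "\<dots> \<le> c" by (rule div_le_dividend)
    finally show False by (simp add: t_def)
  qed
  ultimately show ?thesis
    by (intro exI[of _ "\<lambda>n. path_set (a n)"]) (simp add: wadge_less_def path_set_in_D_omega_open)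
qed

end
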